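(* For every topological tree $S$ with at least two leaves, $$J(S) \geq \frac{(|S|-1)!}{|S|^{|S|-1}-1}.$$
   Context: A topological tree is a finite rooted tree in which every non-leaf vertex has outdegree (number of children) at least $2$; the single-vertex tree is allowed, its vertex being both root and leaf. Trees are considered up to isomorphism of rooted trees (unordered, unlabelled). $|T|$ denotes the number of leaves of $T$. A nonempty set $L$ of leaves of $T$ induces a topological tree: take the smallest subtree of $T$ connecting the leaves in $L$, rooted at the most recent common ancestor of $L$, and suppress (erase, joining the neighbours) all vertices of outdegree $1$. For topological trees $S,T$, $c(S,T)$ is the number of subsets of the leaf set of $T$ whose induced tree is isomorphic, as a rooted tree, to $S$, and $\gamma(S,T)=c(S,T)/\binom{|T|}{|S|}$ (for $|T|\ge |S|$). The inducibility of $S$ is $$J(S)=\limsup_{n\to\infty}\ \max_{\substack{|T|=n\\ T\text{ topological tree}}}\gamma(S,T).$$ *)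

theory Defs
  imports Complex_Main "HOL-Library.Extended_Real"
begin

record 'v rooted_tree =
  verts :: "'v set"
  arcs :: "('v \<times> 'v) set"   (* from parent to child *)
  root :: 'v

definition rooted_tree :: "'v rooted_tree \<Rightarrow> bool" where
  "rooted_tree T \<longleftrightarrow>
     finite (verts T) \<and> root T \<in> verts T \<and> arcs T \<subseteq> verts T \<times> verts T \<and>
     (\<forall>u. (u, root T) \<notin> arcs T) \<and>
     (\<forall>v\<in>verts T - {root T}. \<exists>!u. (u, v) \<in> arcs T) \<and>
     (\<forall>v\<in>verts T. (root T, v) \<in> (arcs T)\<^sup>*)"

definition children :: "'v rooted_tree \<Rightarrow> 'v \<Rightarrow> 'v set" where
  "children T v = {w. (v, w) \<in> arcs T}"

definition outdegree :: "'v rooted_tree \<Rightarrow> 'v \<Rightarrow> nat" where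
  "outdegree T v = card (children T v)"

definition leaves :: "'v rooted_tree \<Rightarrow> 'v set" where
  "leaves T = {v \<in> verts T. children T v = {}}"

definition num_leaves :: "'v rooted_tree \<Rightarrow> nat" where
  "num_leaves T = card (leaves T)"

definition topological_tree :: "'v rooted_tree \<Rightarrow> bool" where
  "topological_tree T \<longleftrightarrow>
     rooted_tree T \<and> (\<forall>v\<in>verts T - leaves T. outdegree T v \<ge> 2)"

definition tree_iso :: "'v rooted_tree \<Rightarrow> 'w rooted_tree \<Rightarrow> bool" where
  "tree_iso S T \<longleftrightarrow>
     (\<exists>f. bij_betw f (verts S) (verts T) \<and> f (root S) = root T \<and>
          (\<forall>u\<in>verts S. \<forall>v\<in>verts S. (u, v) \<in> arcs S \<longleftrightarrow> (f u, f v) \<in> arcs T))"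

definition common_ancestor :: "'v rooted_tree \<Rightarrow> 'v set \<Rightarrow> 'v \<Rightarrow> bool" where
  "common_ancestor T L u \<longleftrightarrow> u \<in> verts T \<and> (\<forall>l\<in>L. (u, l) \<in> (arcs T)\<^sup>*)"

definition mrca :: "'v rooted_tree \<Rightarrow> 'v set \<Rightarrow> 'v" where
  "mrca T L = (THE u. common_ancestor T L u \<and>
                  (\<forall>w. common_ancestor T L w \<longrightarrow> (w, u) \<in> (arcs T)\<^sup>*))"

(* Connectedness of the subgraph induced on U, ignoring the orientation of the arcs. *)
definition connected_in :: "'v rooted_tree \<Rightarrow> 'v set \<Rightarrow> bool" where
  "connected_in T U \<longleftrightarrow>
     (let A = arcs T \<inter> (U \<times> U) in \<forall>u\<in>U. \<forall>v\<in>U. (u, v) \<in> (A \<union> A\<inverse>)\<^sup>*)"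

(* In a tree, connected vertex sets are closed under intersection, so this intersection is
   the vertex set of the smallest subtree containing L. *)
definition spanned_verts :: "'v rooted_tree \<Rightarrow> 'v set \<Rightarrow> 'v set" where
  "spanned_verts T L = \<Inter> {U. L \<subseteq> U \<and> U \<subseteq> verts T \<and> connected_in T U}"

definition spanned_subtree :: "'v rooted_tree \<Rightarrow> 'v set \<Rightarrow> 'v rooted_tree" where
  "spanned_subtree T L =
     \<lparr> verts = spanned_verts T L,
       arcs = arcs T \<inter> (spanned_verts T L \<times> spanned_verts T L),
       root = mrca T L \<rparr>"

(* The new arcs join kept vertices u, w whenever a directed path leads from u to w all of
   whose inner vertices are suppressed.  The root must not have outdegree 1; this holds for
   spanned_subtree T L when L is a nonempty set of leaves, as its root is mrca T L. *)
definition suppress :: "'v rooted_tree \<Rightarrow> 'v rooted_tree" where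
  "suppress T =
     (let K = {v \<in> verts T. outdegree T v \<noteq> 1} in
      \<lparr> verts = K,
        arcs = (arcs T O (arcs T \<inter> ((- K) \<times> UNIV))\<^sup>*) \<inter> (K \<times> K),
        root = root T \<rparr>)"

definition induced_tree :: "'v rooted_tree \<Rightarrow> 'v set \<Rightarrow> 'v rooted_tree" where
  "induced_tree T L = suppress (spanned_subtree T L)"

definition copies :: "'w rooted_tree \<Rightarrow> 'v rooted_tree \<Rightarrow> nat" where
  "copies S T = card {L. L \<noteq> {} \<and> L \<subseteq> leaves T \<and> tree_iso S (induced_tree T L)}"

definition density :: "'w rooted_tree \<Rightarrow> 'v rooted_tree \<Rightarrow> real" where
  "density S T = real (copies S T) / real (num_leaves T choose num_leaves S)"

(* Every finite tree is isomorphic to one with vertices in nat.  For n > 0 the maximum is over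
   a nonempty set, which is finite as density S T takes finitely many values when
   num_leaves T = n. *)
definition max_density :: "'w rooted_tree \<Rightarrow> nat \<Rightarrow> real" where
  "max_density S n =
     Max {density S T | T :: nat rooted_tree. topological_tree T \<and> num_leaves T = n}"

definition inducibility :: "'w rooted_tree \<Rightarrow> ereal" where
  "inducibility S = limsup (\<lambda>n. ereal (max_density S n))"

end

theory Submission
  imports Defs "HOL-Library.FuncSet"
begin

text \<open>Let \<open>s = |S|\<close>, let \<open>T\<^sub>0\<close> be a single vertex and let \<open>T\<^sub>k\<^sub>+\<^sub>1\<close> arise from \<open>S\<close> by grafting a copy of
  \<open>T\<^sub>k\<close> onto every leaf. A set of leaves of \<open>T\<^sub>k\<^sub>+\<^sub>1\<close> induces \<open>S\<close> if it does so inside one of the \<open>s\<close>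
  grafted copies, or if it contains exactly one leaf of each of them. Thus
  \<open>c(S, T\<^sub>k\<^sub>+\<^sub>1) \<ge> s c(S, T\<^sub>k) + s^(k s)\<close>. Solving the recursion and using \<open>binom(s^k, s) \<le> s^(k s) / s!\<close>
  gives density at least \<open>(s-1)! / (s^(s-1) - 1) * (1 - s^(-k(s-1)))\<close> for \<open>T\<^sub>k\<close>.\<close>

subsection \<open>Ancestors in rooted trees\<close>

text \<open>The definitions are not directly computable: \<open>mrca\<close> is a definite
  description, \<open>spanned_verts\<close> an intersection over all connected sets, and
  \<open>suppress\<close> joins vertices through a reflexive transitive closure. Most of the work is
  to evaluate them in two cases. A leaf set inside a full subtree induces the same tree as in that
  subtree alone, which handles the sets inside one grafted copy. A transversal induces
  \<open>S\<close> because every non-leaf of \<open>S\<close> has at least two children: all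
  branchings of \<open>S\<close> survive, while inside a copy only one path to the chosen leaf
  remains and contracts to that leaf.

  The denominator comes from a geometric series. The \<open>s^i\<close> copies at level
  \<open>i\<close> contribute \<open>s^i * s^((k-i-1)*s)\<close> transversals, so consecutive levels
  differ by the factor \<open>s^(1-s)\<close> and the sum is about
  \<open>s^(k*s) / (s^s - s)\<close>. Multiplying by \<open>s! / s^(k*s)\<close> leaves
  \<open>(s-1)! / (s^(s-1) - 1)\<close>. Leaf counts of the form \<open>s^k\<close> are enough, as a
  limsup dominates the limsup of any subsequence.\<close>

lemma arc_in_verts:
  assumes "rooted_tree T" "(u, v) \<in> arcs T"
  shows "u \<in> verts T" "v \<in> verts T"
  using assms by (auto simp: rooted_tree_def)

lemma finite_arcs: "rooted_tree T \<Longrightarrow> finite (arcs T)"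
  unfolding rooted_tree_def by (meson finite_SigmaI finite_subset)

lemma finite_leaves: "rooted_tree T \<Longrightarrow> finite (leaves T)"
  unfolding rooted_tree_def leaves_def by simp

lemma descendant_in_verts:
  assumes "rooted_tree T" "(u, v) \<in> (arcs T)\<^sup>*" "u \<in> verts T"
  shows "v \<in> verts T"
  using assms(2,3) by (induction) (auto dest: arc_in_verts[OF assms(1)])

lemma ancestor_in_verts:
  assumes "rooted_tree T" "(u, v) \<in> (arcs T)\<^sup>*" "v \<in> verts T"
  shows "u \<in> verts T"
  using assms(2,3) by (induction) (auto dest: arc_in_verts[OF assms(1)])

lemma parent_unique:
  assumes "rooted_tree T" "(u, w) \<in> arcs T" "(v, w) \<in> arcs T"
  shows "u = v"
proof -
  have "w \<in> verts T - {root T}"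
    using assms by (auto simp: rooted_tree_def)
  then show ?thesis
    using assms unfolding rooted_tree_def by blast
qed

text \<open>Parents are unique, so two paths ending in \<open>w\<close> agree when read upwards
  until the shorter one stops.\<close>

lemma ancestors_chain:
  assumes "rooted_tree T" "(u, w) \<in> (arcs T)\<^sup>*" "(v, w) \<in> (arcs T)\<^sup>*"
  shows "(u, v) \<in> (arcs T)\<^sup>* \<or> (v, u) \<in> (arcs T)\<^sup>*"
  using assms(2,3)
proof (induction)
  case base
  then show ?case by simp
next
  case (step y z)
  from step.prems show ?case
  proof (cases rule: rtranclE)
    case base
    then show ?thesis using step.hyps by auto
  next
    case (step y')
    then have "y' = y" using parent_unique[OF assms(1)] \<open>(y, z) \<in> arcs T\<close> by blast
    then show ?thesis using step \<open>(v, y) \<in> (arcs T)\<^sup>* \<Longrightarrow> _\<close> by blast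
  qed
qed

text \<open>Acyclicity is derived from reachability. The root has no incoming arc and so lies on no
  cycle; a cycle through a vertex must enter it from its only parent, so freedom from cycles passes
  down every path from the root.\<close>

lemma acyclic_arcs:
  assumes "rooted_tree T"
  shows "acyclic (arcs T)"
proof -
  have no_cycle: "(u, u) \<notin> (arcs T)\<^sup>+" if "(root T, u) \<in> (arcs T)\<^sup>*" for u
    using that
  proof (induction)
    case base
    show ?case using assms unfolding rooted_tree_def by (meson tranclE)
  next
    case (step y z)
    show ?case
    proof
      assume "(z, z) \<in> (arcs T)\<^sup>+"
      then obtain p where "(z, p) \<in> (arcs T)\<^sup>*" "(p, z) \<in> arcs T"
        by (meson tranclD2)
      moreover from this have "p = y" using parent_unique[OF assms] step.hyps by blast
      ultimately have "(y, y) \<in> (arcs T)\<^sup>+" using step.hyps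
        by (meson rtrancl_into_trancl2)
      then show False using step.IH by blast
    qed
  qed
  have "(u, u) \<notin> (arcs T)\<^sup>+" for u
  proof
    assume *: "(u, u) \<in> (arcs T)\<^sup>+"
    then have "u \<in> verts T" using arc_in_verts[OF assms] by (meson tranclE)
    then show False using * no_cycle assms unfolding rooted_tree_def by blast
  qed
  then show ?thesis by (simp add: acyclic_def)
qed

lemma arc_not_ancestor:
  assumes "rooted_tree T" "(u, v) \<in> arcs T"
  shows "(v, u) \<notin> (arcs T)\<^sup>*"
  using acyclic_arcs[OF assms(1)] assms(2) unfolding acyclic_def
  by (meson rtrancl_into_trancl2)

lemma ancestor_antisym:
  assumes "rooted_tree T" "(u, v) \<in> (arcs T)\<^sup>*" "(v, u) \<in> (arcs T)\<^sup>*"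
  shows "u = v"
  using acyclic_impl_antisym_rtrancl[OF acyclic_arcs[OF assms(1)]] assms(2,3)
  by (auto dest: antisymD)

text \<open>A common descendant would make the siblings comparable. A proper path from one to the
  other enters its end from the shared parent \<open>u\<close>, which closes a cycle.\<close>

lemma siblings_no_common_descendant:
  assumes "rooted_tree T" "(u, c) \<in> arcs T" "(u, d) \<in> arcs T"
    and "(c, w) \<in> (arcs T)\<^sup>*" "(d, w) \<in> (arcs T)\<^sup>*"
  shows "c = d"
proof -
  have eq: "x = y" if "(u, x) \<in> arcs T" "(u, y) \<in> arcs T" "(x, y) \<in> (arcs T)\<^sup>*" for x y
    using that(3)
  proof (cases rule: rtranclE)
    case (step z)
    then have "(x, u) \<in> (arcs T)\<^sup>*" using parent_unique[OF assms(1)] that(2) by blast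
    then show ?thesis using arc_not_ancestor[OF assms(1) that(1)] by blast
  qed
  show ?thesis
    using ancestors_chain[OF assms(1,4,5)] eq assms(2,3) by metis
qed

lemma leaf_descendant_exists:
  assumes "rooted_tree T" "v \<in> verts T"
  shows "\<exists>l \<in> leaves T. (v, l) \<in> (arcs T)\<^sup>*"
proof -
  have "wf ((arcs T)\<inverse>)"
    using finite_acyclic_wf_converse finite_arcs acyclic_arcs assms(1) by blast
  then show ?thesis using assms(2)
  proof (induction v rule: wf_induct_rule)
    case (less v)
    show ?case
    proof (cases "v \<in> leaves T")
      case False
      then obtain w where w: "(v, w) \<in> arcs T"
        using less.prems by (auto simp: leaves_def children_def)
      then show ?thesis
        using less.IH[of w] arc_in_verts[OF assms(1) w] by (meson converseI converse_rtrancl_into_rtrancl)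
    qed auto
  qed
qed

text \<open>A vertex other than the root lies below a single child \<open>c\<close> of the root, and
  a second child \<open>d\<close> has a leaf below it that \<open>c\<close> cannot reach. This later
  identifies the most recent common ancestor of a transversal.\<close>

lemma common_ancestor_of_leaves_eq_root:
  assumes "topological_tree T" "root T \<notin> leaves T"
    and "\<And>l. l \<in> leaves T \<Longrightarrow> (v, l) \<in> (arcs T)\<^sup>*"
  shows "v = root T"
proof (rule ccontr)
  assume "v \<noteq> root T"
  have T: "rooted_tree T" using assms(1) by (simp add: topological_tree_def)
  have root: "root T \<in> verts T" using T by (simp add: rooted_tree_def)
  obtain l where "l \<in> leaves T" using leaf_descendant_exists[OF T root] by blast
  then have "v \<in> verts T"
    using ancestor_in_verts[OF T assms(3)] by (auto simp: leaves_def)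
  then have "(root T, v) \<in> (arcs T)\<^sup>*" using T by (simp add: rooted_tree_def)
  then obtain c where c: "(root T, c) \<in> arcs T" "(c, v) \<in> (arcs T)\<^sup>*"
    using \<open>v \<noteq> root T\<close> by (auto elim: converse_rtranclE)
  have "outdegree T (root T) \<ge> 2" using assms root by (simp add: topological_tree_def)
  then have "\<not> children T (root T) \<subseteq> {c}"
    unfolding outdegree_def using card_mono[of "{c}" "children T (root T)"] by auto
  then obtain d where d: "(root T, d) \<in> arcs T" "d \<noteq> c"
    by (auto simp: children_def)
  obtain l where l: "l \<in> leaves T" "(d, l) \<in> (arcs T)\<^sup>*"
    using leaf_descendant_exists[OF T arc_in_verts(2)[OF T d(1)]] by blast
  have "(c, l) \<in> (arcs T)\<^sup>*" using c(2) assms(3)[OF l(1)] by simp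
  then show False
    using siblings_no_common_descendant[OF T c(1) d(1)] l(2) d(2) by blast
qed

subsection \<open>The subtree spanned by a set of vertices\<close>

lemma mrca_eqI:
  assumes "rooted_tree T" "common_ancestor T L m"
    and "\<And>w. common_ancestor T L w \<Longrightarrow> (w, m) \<in> (arcs T)\<^sup>*"
  shows "mrca T L = m"
  unfolding mrca_def
  by (rule the_equality) (use assms ancestor_antisym[OF assms(1)] in blast)+

text \<open>A common ancestor with the fewest descendants works: since \<open>L\<close> is nonempty,
  any two common ancestors are comparable, and one strictly below the choice would have fewer
  descendants.\<close>

lemma mrca_exists:
  assumes "rooted_tree T" "L \<subseteq> verts T" "L \<noteq> {}"
  shows "\<exists>m. common_ancestor T L m \<and> (\<forall>w. common_ancestor T L w \<longrightarrow> (w, m) \<in> (arcs T)\<^sup>*)"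
proof -
  define D where "D u = {v \<in> verts T. (u, v) \<in> (arcs T)\<^sup>*}" for u
  have finD: "finite (D u)" for u
    using assms(1) by (simp add: D_def rooted_tree_def)
  have "common_ancestor T L (root T)"
    using assms by (auto simp: common_ancestor_def rooted_tree_def)
  then obtain m where m: "common_ancestor T L m"
    and min: "\<And>w. common_ancestor T L w \<Longrightarrow> card (D m) \<le> card (D w)"
    using ex_has_least_nat[of "common_ancestor T L" _ "\<lambda>u. card (D u)"] by blast
  have "(w, m) \<in> (arcs T)\<^sup>*" if w: "common_ancestor T L w" for w
  proof (rule ccontr)
    assume "(w, m) \<notin> (arcs T)\<^sup>*"
    moreover have "(w, m) \<in> (arcs T)\<^sup>* \<or> (m, w) \<in> (arcs T)\<^sup>*"
      using assms(3) w m ancestors_chain[OF assms(1)] unfolding common_ancestor_def by blast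
    ultimately have mw: "(m, w) \<in> (arcs T)\<^sup>*" by blast
    then have sub: "D w \<subseteq> D m" by (auto simp: D_def)
    moreover have "m \<in> D m" using m by (simp add: D_def common_ancestor_def)
    moreover have "m \<notin> D w" using \<open>(w, m) \<notin> (arcs T)\<^sup>*\<close> by (simp add: D_def)
    ultimately have "D w \<subset> D m" by blast
    then have "card (D w) < card (D m)" using finD psubset_card_mono by blast
    then show False using min[OF w] by simp
  qed
  then show ?thesis using m by blast
qed

lemma common_ancestor_mrca:
  assumes "rooted_tree T" "L \<subseteq> verts T" "L \<noteq> {}"
  shows "common_ancestor T L (mrca T L)"
    and "common_ancestor T L w \<Longrightarrow> (w, mrca T L) \<in> (arcs T)\<^sup>*"
proof -
  obtain m where m: "common_ancestor T L m" "\<forall>w. common_ancestor T L w \<longrightarrow> (w, m) \<in> (arcs T)\<^sup>*"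
    using mrca_exists[OF assms] by blast
  then have "mrca T L = m" using mrca_eqI[OF assms(1)] by blast
  with m show "common_ancestor T L (mrca T L)"
    and "common_ancestor T L w \<Longrightarrow> (w, mrca T L) \<in> (arcs T)\<^sup>*" by auto
qed

text \<open>An undirected walk can leave the part below \<open>c\<close> only through the arc from
  \<open>v\<close> to \<open>c\<close>, and \<open>v\<close> is missing from
  \<open>U\<close>.\<close>

lemma connected_in_descendants:
  assumes T: "rooted_tree T" and conn: "connected_in T U"
    and c: "(v, c) \<in> arcs T" and v: "v \<notin> U"
    and l: "l \<in> U" "(c, l) \<in> (arcs T)\<^sup>*" and x: "x \<in> U"
  shows "(c, x) \<in> (arcs T)\<^sup>*"
proof -
  let ?A = "arcs T \<inter> (U \<times> U)"
  have "(l, x) \<in> (?A \<union> ?A\<inverse>)\<^sup>*"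
    using conn l(1) x by (auto simp: connected_in_def Let_def)
  then show ?thesis
  proof (induction)
    case base
    show ?case by (rule l(2))
  next
    case (step y z)
    consider "(y, z) \<in> arcs T" | "(z, y) \<in> arcs T" "z \<in> U" using step.hyps by blast
    then show ?case
    proof cases
      case 1
      then show ?thesis using step.IH by simp
    next
      case 2
      from step.IH show ?thesis
      proof (cases rule: rtranclE)
        case base
        then show ?thesis using parent_unique[OF T 2(1)] c v 2(2) by blast
      next
        case (step p)
        then show ?thesis using parent_unique[OF T 2(1)] by blast
      qed
    qed
  qed
qed

text \<open>This turns the intersection into a condition on directed paths. If a connected
  \<open>U\<close> containing \<open>L\<close> missed such a \<open>v\<close>, all of
  \<open>L\<close> would lie below one child \<open>c\<close> of \<open>v\<close>; then
  \<open>c\<close> would be a common ancestor, hence above \<open>mrca T L\<close> and so above its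
  own parent \<open>v\<close>.\<close>

lemma spanned_verts_eq:
  assumes T: "rooted_tree T" and L: "L \<subseteq> verts T" "L \<noteq> {}"
  shows "spanned_verts T L = {v. (mrca T L, v) \<in> (arcs T)\<^sup>* \<and> (\<exists>l\<in>L. (v, l) \<in> (arcs T)\<^sup>*)}"
    (is "_ = ?X")
proof
  note m = common_ancestor_mrca[OF T L]
  let ?m = "mrca T L"
  let ?A = "arcs T \<inter> (?X \<times> ?X)"
  \<comment> \<open>Every vertex on the path from \<open>?m\<close> to \<open>v\<close> is also
    above the element of \<open>L\<close> below \<open>v\<close>, so the path never leaves
    \<open>?X\<close>.\<close>
  have from_m: "(?m, v) \<in> ?A\<^sup>*" if "(?m, v) \<in> (arcs T)\<^sup>*" "\<exists>l\<in>L. (v, l) \<in> (arcs T)\<^sup>*" for v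
    using that
  proof (induction)
    case base
    show ?case by simp
  next
    case (step y z)
    then have y: "\<exists>l\<in>L. (y, l) \<in> (arcs T)\<^sup>*" by (meson converse_rtrancl_into_rtrancl)
    with step have "(y, z) \<in> ?A" by auto
    then show ?case by (rule rtrancl_into_rtrancl[OF step.IH[OF y]])
  qed
  have "connected_in T ?X"
    unfolding connected_in_def Let_def
  proof (intro ballI)
    fix u v assume "u \<in> ?X" "v \<in> ?X"
    then have "(?m, u) \<in> ?A\<^sup>*" "(?m, v) \<in> ?A\<^sup>*" using from_m by auto
    then have "(u, ?m) \<in> (?A \<union> ?A\<inverse>)\<^sup>*" "(?m, v) \<in> (?A \<union> ?A\<inverse>)\<^sup>*"
      by (meson Un_upper2 rtrancl_converseI rtrancl_mono subsetD, meson Un_upper1 rtrancl_mono subsetD)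
    then show "(u, v) \<in> (?A \<union> ?A\<inverse>)\<^sup>*" by (rule rtrancl_trans)
  qed
  moreover have "L \<subseteq> ?X" using m(1) by (auto simp: common_ancestor_def)
  moreover have "?X \<subseteq> verts T"
    using m(1) descendant_in_verts[OF T] by (auto simp: common_ancestor_def)
  ultimately show "spanned_verts T L \<subseteq> ?X" unfolding spanned_verts_def by blast
  show "?X \<subseteq> spanned_verts T L"
    unfolding spanned_verts_def
  proof (intro subsetI InterI)
    fix v U assume v: "v \<in> ?X" and "U \<in> {U. L \<subseteq> U \<and> U \<subseteq> verts T \<and> connected_in T U}"
    then have U: "L \<subseteq> U" "connected_in T U" by auto
    show "v \<in> U"
    proof (rule ccontr)
      assume "v \<notin> U"
      obtain l where l: "l \<in> L" "(v, l) \<in> (arcs T)\<^sup>*" using v by blast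
      then have "v \<noteq> l" using U \<open>v \<notin> U\<close> by blast
      then obtain c where c: "(v, c) \<in> arcs T" "(c, l) \<in> (arcs T)\<^sup>*"
        using l(2) by (auto elim: converse_rtranclE)
      have "common_ancestor T L c"
        unfolding common_ancestor_def
        using connected_in_descendants[OF T U(2) c(1) \<open>v \<notin> U\<close> _ c(2)] l(1) U(1)
          arc_in_verts[OF T c(1)] by blast
      then have "(c, v) \<in> (arcs T)\<^sup>*" using m(2)[of c] v by auto
      then show False using arc_not_ancestor[OF T c(1)] by blast
    qed
  qed
qed

subsection \<open>Embedding a tree as the full subtree below a vertex\<close>

definition map_tree :: "('v \<Rightarrow> 'w) \<Rightarrow> 'v rooted_tree \<Rightarrow> 'w rooted_tree" where
  "map_tree f T = \<lparr>verts = f ` verts T, arcs = map_prod f f ` arcs T, root = f (root T)\<rparr>"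

lemma map_tree_sel [simp]:
  "verts (map_tree f T) = f ` verts T" "arcs (map_tree f T) = map_prod f f ` arcs T"
  "root (map_tree f T) = f (root T)"
  by (simp_all add: map_tree_def)

lemma map_prod_image_iff:
  assumes "inj_on f V" "R \<subseteq> V \<times> V" "u \<in> V" "v \<in> V"
  shows "(f u, f v) \<in> map_prod f f ` R \<longleftrightarrow> (u, v) \<in> R"
  using assms by (auto dest: inj_onD)

text \<open>Injectivity forces consecutive arcs of a path in the image to meet in one common
  preimage, so the path lifts.\<close>

lemma rtrancl_map_prod_image:
  assumes "inj_on f V" "R \<subseteq> V \<times> V" "u \<in> V" "(f u, y) \<in> (map_prod f f ` R)\<^sup>*"
  shows "\<exists>v \<in> V. y = f v \<and> (u, v) \<in> R\<^sup>*"
  using assms(4)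
proof (induction)
  case base
  then show ?case using assms(3) by blast
next
  case (step y z)
  then obtain v a b where "v \<in> V" "y = f v" "(u, v) \<in> R\<^sup>*" "(a, b) \<in> R" "y = f a" "z = f b"
    by auto
  moreover from this have "a = v" "b \<in> V" using assms(1,2) by (auto dest: inj_onD)
  ultimately show ?case using rtrancl_into_rtrancl[of u v R b] by blast
qed

lemma rtrancl_map_prod_imageI:
  assumes "(u, v) \<in> R\<^sup>*"
  shows "(f u, f v) \<in> (map_prod f f ` R)\<^sup>*"
  using assms by (induction) (auto intro: rtrancl_into_rtrancl)

lemma children_map_tree:
  assumes "inj_on f (verts T)" "arcs T \<subseteq> verts T \<times> verts T" "v \<in> verts T"
  shows "children (map_tree f T) (f v) = f ` children T v"
  using map_prod_image_iff[OF assms(1,2,3)] assms by (fastforce simp: children_def)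

lemma outdegree_map_tree:
  assumes "inj_on f (verts T)" "arcs T \<subseteq> verts T \<times> verts T" "v \<in> verts T"
  shows "outdegree (map_tree f T) (f v) = outdegree T v"
  unfolding outdegree_def children_map_tree[OF assms]
  by (rule card_image) (use assms in \<open>auto simp: children_def intro: inj_on_subset\<close>)

lemma leaves_map_tree:
  assumes "inj_on f (verts T)" "arcs T \<subseteq> verts T \<times> verts T"
  shows "leaves (map_tree f T) = f ` leaves T"
  using children_map_tree[OF assms] by (auto simp: leaves_def)

lemma tree_iso_map_tree:
  assumes "inj_on f (verts T)" "arcs T \<subseteq> verts T \<times> verts T"
  shows "tree_iso T (map_tree f T)"
  unfolding tree_iso_def
  by (rule exI[of _ f]) (use assms map_prod_image_iff[OF assms] in \<open>auto simp: bij_betw_def\<close>)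

lemma tree_iso_trans:
  assumes "tree_iso S T" "tree_iso T U"
  shows "tree_iso S U"
proof -
  obtain f where f: "bij_betw f (verts S) (verts T)" "f (root S) = root T"
    "\<forall>u\<in>verts S. \<forall>v\<in>verts S. (u, v) \<in> arcs S \<longleftrightarrow> (f u, f v) \<in> arcs T"
    using assms(1) by (auto simp: tree_iso_def)
  obtain g where g: "bij_betw g (verts T) (verts U)" "g (root T) = root U"
    "\<forall>u\<in>verts T. \<forall>v\<in>verts T. (u, v) \<in> arcs T \<longleftrightarrow> (g u, g v) \<in> arcs U"
    using assms(2) by (auto simp: tree_iso_def)
  have "f u \<in> verts T" if "u \<in> verts S" for u using f(1) that by (rule bij_betwE[rule_format])
  then show ?thesis
    unfolding tree_iso_def using bij_betw_trans[OF f(1) g(1)] f(2,3) g(2,3)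
    by (intro exI[of _ "g \<circ> f"]) auto
qed

text \<open>Injectivity preserves outdegrees, so the same vertices are kept on both sides, and paths
  through suppressed vertices lift and project along \<open>f\<close>. The result is an equality of
  trees, which lets it be chained by rewriting.\<close>

lemma suppress_map_tree:
  assumes inj: "inj_on f (verts T)" and arcs: "arcs T \<subseteq> verts T \<times> verts T"
  shows "suppress (map_tree f T) = map_tree f (suppress T)"
proof -
  let ?V = "verts T" and ?A = "arcs T" and ?F = "map_prod f f"
  define K where "K = {v \<in> ?V. outdegree T v \<noteq> 1}"
  define R where "R = ?A \<inter> ((- K) \<times> UNIV)"
  have K: "{v \<in> verts (map_tree f T). outdegree (map_tree f T) v \<noteq> 1} = f ` K"
    unfolding K_def using outdegree_map_tree[OF inj arcs] by auto
  have KV: "K \<subseteq> ?V" by (auto simp: K_def)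
  have RV: "R \<subseteq> ?V \<times> ?V" using arcs by (auto simp: R_def)
  have R: "?F ` ?A \<inter> ((- (f ` K)) \<times> UNIV) = ?F ` R"
    unfolding R_def using inj arcs KV by (auto simp: image_iff dest: inj_onD)
  have "(?F ` ?A O (?F ` R)\<^sup>*) \<inter> (f ` K \<times> f ` K) = ?F ` ((?A O R\<^sup>*) \<inter> (K \<times> K))"
  proof (intro equalityI subrelI)
    fix x y assume "(x, y) \<in> (?F ` ?A O (?F ` R)\<^sup>*) \<inter> (f ` K \<times> f ` K)"
    then have xy: "(x, y) \<in> ?F ` ?A O (?F ` R)\<^sup>*" "x \<in> f ` K" "y \<in> f ` K"
      by (simp_all only: Int_iff mem_Sigma_iff)
    from xy(1) obtain c where c: "(x, c) \<in> ?F ` ?A" "(c, y) \<in> (?F ` R)\<^sup>*" by (rule relcompE) simp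
    from xy(2,3) obtain u v where uv: "x = f u" "y = f v" "u \<in> K" "v \<in> K" by (elim imageE)
    from c(1) obtain a b where ab: "(a, b) \<in> ?A" "f a = f u" "c = f b" using uv(1) by auto
    have "a = u" "b \<in> ?V" using uv ab arcs KV inj by (auto dest: inj_onD)
    obtain v' where "v' \<in> ?V" "f v = f v'" "(b, v') \<in> R\<^sup>*"
      using rtrancl_map_prod_image[OF inj RV \<open>b \<in> ?V\<close>] c(2) uv(2) ab(3) by blast
    moreover from this have "v = v'" using uv(4) KV inj by (auto dest: inj_onD)
    ultimately have "(u, v) \<in> (?A O R\<^sup>*) \<inter> (K \<times> K)"
      using uv ab \<open>a = u\<close> by blast
    then show "(x, y) \<in> ?F ` ((?A O R\<^sup>*) \<inter> (K \<times> K))"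
      using uv by (auto simp only: map_prod_imageI)
  next
    fix x y assume "(x, y) \<in> ?F ` ((?A O R\<^sup>*) \<inter> (K \<times> K))"
    then obtain u b v where u: "x = f u" "y = f v" "u \<in> K" "v \<in> K" "(u, b) \<in> ?A" "(b, v) \<in> R\<^sup>*"
      by auto
    then have "(f u, f b) \<in> ?F ` ?A" "(f b, f v) \<in> (?F ` R)\<^sup>*"
      using rtrancl_map_prod_imageI[of b v R f] by auto
    then show "(x, y) \<in> (?F ` ?A O (?F ` R)\<^sup>*) \<inter> (f ` K \<times> f ` K)"
      unfolding u(1,2) using u(3,4) by (intro IntI relcompI[of _ "f b"] SigmaI imageI)
  qed
  then show ?thesis
    unfolding suppress_def Let_def K
    unfolding map_tree_def K_def[symmetric]
    by (simp add: R R_def[symmetric])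
qed

text \<open>The condition on children says that nothing but images of \<open>f\<close> hangs below
  \<open>f (root T)\<close>, so \<open>T\<close> becomes a full subtree of \<open>T'\<close>. One
  notion serves two purposes: the copy of \<open>T\<close> at a leaf of \<open>S\<close>, and the
  relabelling of a whole tree.\<close>

locale subtree_embedding =
  fixes T :: "'v rooted_tree" and T' :: "'w rooted_tree" and f :: "'v \<Rightarrow> 'w"
  assumes T: "rooted_tree T" and T': "rooted_tree T'"
    and inj: "inj_on f (verts T)" and root_in: "f (root T) \<in> verts T'"
    and children_eq: "\<And>v. v \<in> verts T \<Longrightarrow> children T' (f v) = f ` children T v"
begin

lemma arc_iff: "u \<in> verts T \<Longrightarrow> v \<in> verts T \<Longrightarrow> (f u, f v) \<in> arcs T' \<longleftrightarrow> (u, v) \<in> arcs T"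
  using children_eq[of u] arc_in_verts[OF T] inj
  by (auto simp: children_def set_eq_iff image_iff dest: inj_onD)

lemma descendant_preimage:
  assumes "u \<in> verts T" "(f u, y) \<in> (arcs T')\<^sup>*"
  shows "\<exists>v \<in> verts T. y = f v \<and> (u, v) \<in> (arcs T)\<^sup>*"
  using assms(2)
proof (induction)
  case base
  then show ?case using assms(1) by blast
next
  case (step y z)
  then obtain v where v: "v \<in> verts T" "y = f v" "(u, v) \<in> (arcs T)\<^sup>*" by blast
  then have "z \<in> f ` children T v" using step.hyps children_eq by (auto simp: children_def)
  then obtain w where "z = f w" "(v, w) \<in> arcs T" by (auto simp: children_def)
  then show ?case using v arc_in_verts(2)[OF T] rtrancl_into_rtrancl[of u v "arcs T" w] by blast
qed

lemma descendant_image: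
  assumes "u \<in> verts T" "(u, v) \<in> (arcs T)\<^sup>*"
  shows "(f u, f v) \<in> (arcs T')\<^sup>*"
  using assms(2)
proof (induction)
  case (step y z)
  then have "(f y, f z) \<in> arcs T'" using arc_iff arc_in_verts[OF T] by blast
  then show ?case using step.IH by simp
qed simp

lemma descendant_iff:
  assumes "u \<in> verts T" "v \<in> verts T"
  shows "(f u, f v) \<in> (arcs T')\<^sup>* \<longleftrightarrow> (u, v) \<in> (arcs T)\<^sup>*"
  using descendant_preimage[OF assms(1), of "f v"] descendant_image[OF assms(1)] assms(2)
    inj_onD[OF inj] by blast

lemma verts_image: "f ` verts T \<subseteq> verts T'"
proof -
  have "(f (root T), f v) \<in> (arcs T')\<^sup>*" if "v \<in> verts T" for v
    using T that by (intro descendant_image) (auto simp: rooted_tree_def)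
  then show ?thesis using descendant_in_verts[OF T' _ root_in] by blast
qed

lemma leaves_image: "f ` leaves T \<subseteq> leaves T'"
  using verts_image children_eq by (auto simp: leaves_def)

lemma mrca_image:
  assumes L: "L \<subseteq> verts T" "L \<noteq> {}"
  shows "mrca T' (f ` L) = f (mrca T L)"
proof (rule mrca_eqI[OF T'])
  note m = common_ancestor_mrca[OF T L]
  have mV: "mrca T L \<in> verts T" using m(1) by (simp add: common_ancestor_def)
  show ca: "common_ancestor T' (f ` L) (f (mrca T L))"
    using m(1) verts_image descendant_image by (auto simp: common_ancestor_def)
  fix w assume w: "common_ancestor T' (f ` L) w"
  obtain l where "l \<in> L" using L by blast
  then consider "(w, f (mrca T L)) \<in> (arcs T')\<^sup>*" | "(f (mrca T L), w) \<in> (arcs T')\<^sup>*"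
    using ancestors_chain[OF T'] w ca unfolding common_ancestor_def by blast
  then show "(w, f (mrca T L)) \<in> (arcs T')\<^sup>*"
  proof cases
    \<comment> \<open>A candidate below the image of \<open>mrca T L\<close> lies in the image of
      \<open>f\<close>, so it pulls back to a common ancestor of \<open>L\<close> in
      \<open>T\<close>.\<close>
    case 2
    then obtain v where v: "v \<in> verts T" "w = f v"
      using descendant_preimage[OF mV] by blast
    then have "common_ancestor T L v"
      using w L descendant_iff by (auto simp: common_ancestor_def)
    then show ?thesis using v m(2) descendant_image by blast
  qed
qed

lemma spanned_subtree_image:
  assumes L: "L \<subseteq> verts T" "L \<noteq> {}"
  shows "spanned_subtree T' (f ` L) = map_tree f (spanned_subtree T L)"
proof -
  have L': "f ` L \<subseteq> verts T'" "f ` L \<noteq> {}" using L verts_image by auto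
  have mV: "mrca T L \<in> verts T"
    using common_ancestor_mrca(1)[OF T L] by (simp add: common_ancestor_def)
  have V: "spanned_verts T L \<subseteq> verts T"
    using descendant_in_verts[OF T _ mV] by (auto simp: spanned_verts_eq[OF T L])
  have eq: "spanned_verts T' (f ` L) = f ` spanned_verts T L"
    unfolding spanned_verts_eq[OF T' L'] spanned_verts_eq[OF T L] mrca_image[OF L]
  proof (intro equalityI subsetI)
    fix y assume y: "y \<in> {v. (f (mrca T L), v) \<in> (arcs T')\<^sup>* \<and> (\<exists>l\<in>f ` L. (v, l) \<in> (arcs T')\<^sup>*)}"
    then obtain v where v: "v \<in> verts T" "y = f v" "(mrca T L, v) \<in> (arcs T)\<^sup>*"
      using descendant_preimage[OF mV] by blast
    then have "\<exists>l\<in>L. (v, l) \<in> (arcs T)\<^sup>*" using y L descendant_iff by blast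
    then show "y \<in> f ` {v. (mrca T L, v) \<in> (arcs T)\<^sup>* \<and> (\<exists>l\<in>L. (v, l) \<in> (arcs T)\<^sup>*)}"
      using v by blast
  qed (use mV descendant_image descendant_in_verts[OF T _ mV] in blast)
  have "arcs T' \<inter> (f ` spanned_verts T L \<times> f ` spanned_verts T L)
      = map_prod f f ` (arcs T \<inter> (spanned_verts T L \<times> spanned_verts T L))"
  proof (intro equalityI subsetI)
    fix p assume "p \<in> arcs T' \<inter> (f ` spanned_verts T L \<times> f ` spanned_verts T L)"
    then obtain u v where p: "p = (f u, f v)" "(f u, f v) \<in> arcs T'"
      "u \<in> spanned_verts T L" "v \<in> spanned_verts T L" by blast
    then have "(u, v) \<in> arcs T" using V arc_iff by blast
    with p show "p \<in> map_prod f f ` (arcs T \<inter> (spanned_verts T L \<times> spanned_verts T L))"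
      by auto
  next
    fix p assume "p \<in> map_prod f f ` (arcs T \<inter> (spanned_verts T L \<times> spanned_verts T L))"
    then obtain u v where "p = (f u, f v)" "(u, v) \<in> arcs T"
      "u \<in> spanned_verts T L" "v \<in> spanned_verts T L" by auto
    then show "p \<in> arcs T' \<inter> (f ` spanned_verts T L \<times> f ` spanned_verts T L)"
      using V arc_iff by blast
  qed
  then show ?thesis
    by (simp add: spanned_subtree_def map_tree_def eq mrca_image[OF L])
qed

lemma induced_tree_image:
  assumes L: "L \<subseteq> verts T" "L \<noteq> {}"
  shows "induced_tree T' (f ` L) = map_tree f (induced_tree T L)"
    and "tree_iso (induced_tree T L) (induced_tree T' (f ` L))"
proof -
  have mV: "mrca T L \<in> verts T"
    using common_ancestor_mrca(1)[OF T L] by (simp add: common_ancestor_def)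
  have V: "spanned_verts T L \<subseteq> verts T"
    using descendant_in_verts[OF T _ mV] by (auto simp: spanned_verts_eq[OF T L])
  then show eq: "induced_tree T' (f ` L) = map_tree f (induced_tree T L)"
    unfolding induced_tree_def spanned_subtree_image[OF L]
    by (intro suppress_map_tree inj_on_subset[OF inj]) (auto simp: spanned_subtree_def)
  show "tree_iso (induced_tree T L) (induced_tree T' (f ` L))"
    unfolding eq
    by (rule tree_iso_map_tree)
      (use V in \<open>auto simp: induced_tree_def suppress_def Let_def spanned_subtree_def intro: inj_on_subset[OF inj]\<close>)
qed

lemma copy_image:
  assumes "L \<noteq> {}" "L \<subseteq> leaves T" "tree_iso S (induced_tree T L)"
  shows "f ` L \<noteq> {} \<and> f ` L \<subseteq> leaves T' \<and> tree_iso S (induced_tree T' (f ` L))"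
proof -
  have "L \<subseteq> verts T" using assms(2) by (auto simp: leaves_def)
  then show ?thesis
    using assms leaves_image tree_iso_trans[OF assms(3) induced_tree_image(2)] by blast
qed

end

subsection \<open>Grafting a tree onto every leaf\<close>

text \<open>The root of the copy of \<open>T\<close> at a leaf \<open>l\<close> of \<open>S\<close> is \<open>(l, root T)\<close>, which is identified with \<open>l\<close>
  itself; hence an inner vertex \<open>v\<close> of \<open>S\<close> is represented by \<open>(v, root T)\<close>.\<close>

definition graft :: "'v rooted_tree \<Rightarrow> 'w rooted_tree \<Rightarrow> ('v \<times> 'w) rooted_tree" where
  "graft S T =
    \<lparr>verts = {(v, x). v \<in> verts S \<and> x \<in> verts T \<and> (v \<in> leaves S \<or> x = root T)},
     arcs = {((u, x), (v, y)). x = root T \<and> y = root T \<and> (u, v) \<in> arcs S \<or>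
                               u = v \<and> u \<in> leaves S \<and> (x, y) \<in> arcs T},
     root = (root S, root T)\<rparr>"

lemma verts_graft: "(v, x) \<in> verts (graft S T) \<longleftrightarrow>
    v \<in> verts S \<and> x \<in> verts T \<and> (v \<in> leaves S \<or> x = root T)"
  by (simp add: graft_def)

lemma arcs_graft: "((u, x), (v, y)) \<in> arcs (graft S T) \<longleftrightarrow>
    x = root T \<and> y = root T \<and> (u, v) \<in> arcs S \<or> u = v \<and> u \<in> leaves S \<and> (x, y) \<in> arcs T"
  by (simp add: graft_def)

lemma root_graft: "root (graft S T) = (root S, root T)"
  by (simp add: graft_def)

lemma leaf_no_child: "l \<in> leaves T \<Longrightarrow> (l, v) \<notin> arcs T"
  by (auto simp: leaves_def children_def)

locale graft_trees =
  fixes S :: "'v rooted_tree" and T :: "'w rooted_tree"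
  assumes top_S: "topological_tree S" and top_T: "topological_tree T"
    and root_S: "root S \<notin> leaves S"
begin

abbreviation "G \<equiv> graft S T"

lemma S: "rooted_tree S" and T: "rooted_tree T"
  using top_S top_T by (auto simp: topological_tree_def)

lemma root_T_in: "root T \<in> verts T" and root_S_in: "root S \<in> verts S"
  using T S by (auto simp: rooted_tree_def)

lemma children_graft_inner:
  "v \<notin> leaves S \<Longrightarrow> children G (v, root T) = (\<lambda>w. (w, root T)) ` children S v"
  by (auto simp: children_def arcs_graft)

lemma children_graft_leaf: "l \<in> leaves S \<Longrightarrow> children G (l, x) = Pair l ` children T x"
  by (auto simp: children_def arcs_graft dest: leaf_no_child)

lemma graft_path_inner:
  assumes "(u, v) \<in> (arcs S)\<^sup>*"
  shows "((u, root T), (v, root T)) \<in> (arcs G)\<^sup>*"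
  using assms
proof induction
  case (step y z)
  then have "((y, root T), (z, root T)) \<in> arcs G" by (simp add: arcs_graft)
  then show ?case using step.IH by simp
qed simp

lemma graft_path_leaf:
  assumes "l \<in> leaves S" "(x, y) \<in> (arcs T)\<^sup>*"
  shows "((l, x), (l, y)) \<in> (arcs G)\<^sup>*"
  using assms(2)
proof induction
  case (step y z)
  then have "((l, y), (l, z)) \<in> arcs G" using assms(1) by (simp add: arcs_graft)
  then show ?case using step.IH by simp
qed simp

text \<open>Arcs inside a copy of \<open>T\<close> keep the first component, so the projection
  contracts each copy to its leaf of \<open>S\<close>.\<close>

lemma graft_path_fst:
  assumes "(p, q) \<in> (arcs G)\<^sup>*"
  shows "(fst p, fst q) \<in> (arcs S)\<^sup>*"
  using assms
proof induction
  case (step q r)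
  then have "fst q = fst r \<or> (fst q, fst r) \<in> arcs S"
    by (cases q, cases r) (auto simp: arcs_graft)
  then show ?case using step.IH by auto
qed simp

lemma rooted_tree_graft: "rooted_tree G"
  unfolding rooted_tree_def
proof (intro conjI ballI allI)
  have "verts G \<subseteq> verts S \<times> verts T" by (auto simp: verts_graft)
  then show "finite (verts G)"
    using S T by (auto simp: rooted_tree_def intro: finite_subset)
  show "root G \<in> verts G"
    using root_S_in root_T_in by (simp add: verts_graft root_graft)
  show "arcs G \<subseteq> verts G \<times> verts G"
    using arc_in_verts[OF S] arc_in_verts[OF T] root_T_in
    by (auto simp: verts_graft arcs_graft leaves_def)
  show "(p, root G) \<notin> arcs G" for p
    using S T by (cases p) (auto simp: arcs_graft root_graft rooted_tree_def)
next
  fix p assume p: "p \<in> verts G - {root G}"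
  obtain v y where [simp]: "p = (v, y)" by fastforce
  show "\<exists>!q. (q, p) \<in> arcs G"
  \<comment> \<open>The first case includes the roots of the copies: as \<open>root T\<close> has no
    incoming arc in \<open>T\<close>, their parent can only come from an arc of
    \<open>S\<close>.\<close>
  proof (cases "y = root T")
    case True
    then have "v \<in> verts S - {root S}" using p by (auto simp: verts_graft root_graft)
    then obtain u where u: "(u, v) \<in> arcs S" using S unfolding rooted_tree_def by blast
    show ?thesis
    proof (rule ex1I[of _ "(u, root T)"])
      show "((u, root T), p) \<in> arcs G" using u True by (simp add: arcs_graft)
      fix q assume "(q, p) \<in> arcs G"
      moreover have "(x, root T) \<notin> arcs T" for x using T by (simp add: rooted_tree_def)
      ultimately show "q = (u, root T)"
        using parent_unique[OF S u] True by (cases q) (auto simp: arcs_graft)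
    qed
  next
    case False
    then have v: "v \<in> leaves S" "y \<in> verts T - {root T}" using p by (auto simp: verts_graft)
    then obtain x where x: "(x, y) \<in> arcs T" using T unfolding rooted_tree_def by blast
    show ?thesis
    proof (rule ex1I[of _ "(v, x)"])
      show "((v, x), p) \<in> arcs G" using x v by (simp add: arcs_graft)
      show "q = (v, x)" if "(q, p) \<in> arcs G" for q
        using parent_unique[OF T x] False that by (cases q) (auto simp: arcs_graft)
    qed
  qed
next
  fix p assume p: "p \<in> verts G"
  obtain v y where [simp]: "p = (v, y)" by fastforce
  have "(root S, v) \<in> (arcs S)\<^sup>*" "(root T, y) \<in> (arcs T)\<^sup>*"
    using p S T by (auto simp: verts_graft rooted_tree_def)
  then have "((root S, root T), (v, root T)) \<in> (arcs G)\<^sup>*" "((v, root T), p) \<in> (arcs G)\<^sup>*"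
    using graft_path_inner graft_path_leaf[of v "root T" y] p by (auto simp: verts_graft)
  then show "(root G, p) \<in> (arcs G)\<^sup>*" by (simp add: root_graft)
qed

lemma leaves_graft: "leaves G = leaves S \<times> leaves T"
proof (intro equalityI subrelI)
  fix v x assume a: "(v, x) \<in> leaves G"
  then have ver: "(v, x) \<in> verts G" "children G (v, x) = {}" by (auto simp: leaves_def)
  have "v \<in> leaves S"
  proof (rule ccontr)
    assume v: "v \<notin> leaves S"
    then have "x = root T" using ver by (simp add: verts_graft)
    then have "children S v = {}" using ver children_graft_inner[OF v] by simp
    then show False using v ver by (simp add: leaves_def verts_graft)
  qed
  then show "(v, x) \<in> leaves S \<times> leaves T"
    using ver children_graft_leaf by (simp add: leaves_def[of T] verts_graft)
next
  fix v x assume "(v, x) \<in> leaves S \<times> leaves T"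
  then show "(v, x) \<in> leaves G"
    using children_graft_leaf by (auto simp: leaves_def verts_graft)
qed

lemma num_leaves_graft: "num_leaves G = num_leaves S * num_leaves T"
  by (simp add: num_leaves_def leaves_graft card_cartesian_product)

lemma topological_tree_graft: "topological_tree G"
  unfolding topological_tree_def
proof (intro conjI ballI)
  show "rooted_tree G" by (rule rooted_tree_graft)
  fix p assume p: "p \<in> verts G - leaves G"
  obtain v x where [simp]: "p = (v, x)" by fastforce
  show "outdegree G p \<ge> 2"
  proof (cases "v \<in> leaves S")
    case True
    then have "x \<in> verts T - leaves T" using p by (auto simp: verts_graft leaves_graft)
    then have "outdegree T x \<ge> 2" using top_T by (simp add: topological_tree_def)
    then show ?thesis
      using True by (simp add: outdegree_def children_graft_leaf card_image inj_on_def)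
  next
    case False
    then have "x = root T" "v \<in> verts S - leaves S" using p by (auto simp: verts_graft)
    then have "outdegree S v \<ge> 2" using top_S by (simp add: topological_tree_def)
    then show ?thesis
      using False \<open>x = root T\<close> by (simp add: outdegree_def children_graft_inner card_image inj_on_def)
  qed
qed

lemma embedding_at_leaf:
  assumes "l \<in> leaves S"
  shows "subtree_embedding T G (Pair l)"
proof
  show "Pair l (root T) \<in> verts G"
    using assms root_T_in by (auto simp: verts_graft leaves_def)
qed (use T rooted_tree_graft children_graft_leaf[OF assms] in \<open>auto simp: inj_on_def\<close>)

text \<open>The spanned subtree is \<open>S\<close> with a path to the chosen leaf
  \<open>f l\<close> attached at each leaf \<open>l\<close>. The inner vertices of \<open>S\<close>
  keep their outdegree of at least 2, whereas on each attached path only the last vertex escapes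
  suppression.\<close>

lemma tree_iso_transversal:
  assumes f: "f \<in> leaves S \<rightarrow> leaves T"
  defines "L \<equiv> (\<lambda>l. (l, f l)) ` leaves S"
  shows "tree_iso S (induced_tree G L)"
proof -
  let ?r = "root T"
  \<comment> \<open>A leaf goes to the end of its attached path, since the root of the copy is
    suppressed unless it is itself the chosen leaf. The inverse of \<open>g\<close> on the kept
    vertices is \<open>fst\<close>.\<close>
  define g where "g v = (if v \<in> leaves S then (v, f v) else (v, ?r))" for v
  define V where "V = spanned_verts G L"
  define K where "K = {v \<in> V. outdegree (spanned_subtree G L) v \<noteq> 1}"
  define A where "A = arcs G \<inter> (V \<times> V)"
  have fT: "f l \<in> leaves T" "f l \<in> verts T" if "l \<in> leaves S" for l
    using f that by (auto simp: leaves_def)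
  have LG: "L \<subseteq> verts G" "L \<noteq> {}"
    using fT leaf_descendant_exists[OF S root_S_in] by (auto simp: L_def verts_graft leaves_def[of S])
  have to_fl: "((v, ?r), (l, f l)) \<in> (arcs G)\<^sup>*"
    if "l \<in> leaves S" "(v, l) \<in> (arcs S)\<^sup>*" for v l
  proof -
    have "(?r, f l) \<in> (arcs T)\<^sup>*" using fT[OF that(1)] T by (simp add: rooted_tree_def)
    then show ?thesis
      using graft_path_inner[OF that(2)] graft_path_leaf[OF that(1)] by (meson rtrancl_trans)
  qed
  have mrca: "mrca G L = (root S, ?r)"
  proof (rule mrca_eqI[OF rooted_tree_graft])
    show "common_ancestor G L (root S, ?r)"
      using to_fl S root_S_in root_T_in
      by (auto simp: common_ancestor_def L_def verts_graft rooted_tree_def leaves_def)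
    fix p assume p: "common_ancestor G L p"
    have "(fst p, l) \<in> (arcs S)\<^sup>*" if "l \<in> leaves S" for l
      using p that graft_path_fst[of p "(l, f l)"] by (auto simp: common_ancestor_def L_def)
    then have "fst p = root S"
      using common_ancestor_of_leaves_eq_root[OF top_S root_S] by blast
    then have "p = (root S, ?r)"
      using p root_S by (cases p) (auto simp: common_ancestor_def verts_graft)
    then show "(p, (root S, ?r)) \<in> (arcs G)\<^sup>*" by simp
  qed
  have V_sub: "V \<subseteq> verts G"
    unfolding V_def spanned_verts_eq[OF rooted_tree_graft LG] mrca
    using descendant_in_verts[OF rooted_tree_graft, of "(root S, ?r)"] root_S_in root_T_in
    by (auto simp: verts_graft)
  have V_inner: "(v, ?r) \<in> V" if v: "v \<in> verts S" for v
  proof -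
    obtain l where "l \<in> leaves S" "(v, l) \<in> (arcs S)\<^sup>*"
      using leaf_descendant_exists[OF S v] by blast
    then show ?thesis
      using v S graft_path_inner[of "root S" v] to_fl
      unfolding V_def spanned_verts_eq[OF rooted_tree_graft LG] mrca
      by (auto simp: L_def rooted_tree_def)
  qed
  \<comment> \<open>Descendants of \<open>(l, x)\<close> stay in the copy at \<open>l\<close>, where
    \<open>(l, f l)\<close> is the only element of \<open>L\<close>; the spanned part of the copy is
    therefore a path.\<close>
  have V_leaf: "(l, x) \<in> V \<longleftrightarrow> (x, f l) \<in> (arcs T)\<^sup>*" if l: "l \<in> leaves S" for l x
  proof
    assume "(l, x) \<in> V"
    then obtain k where k: "k \<in> leaves S" "((l, x), (k, f k)) \<in> (arcs G)\<^sup>*" and x: "x \<in> verts T"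
      using V_sub unfolding V_def spanned_verts_eq[OF rooted_tree_graft LG]
      by (auto simp: L_def verts_graft)
    interpret subtree_embedding T G "Pair l" by (rule embedding_at_leaf[OF l])
    show "(x, f l) \<in> (arcs T)\<^sup>*"
      using descendant_preimage[OF x k(2)] by auto
  next
    assume x: "(x, f l) \<in> (arcs T)\<^sup>*"
    have "x \<in> verts T" by (rule ancestor_in_verts[OF T x fT(2)[OF l]])
    then have "(root G, (l, x)) \<in> (arcs G)\<^sup>*"
      using rooted_tree_graft l by (auto simp: rooted_tree_def verts_graft leaves_def)
    then show "(l, x) \<in> V"
      using graft_path_leaf[OF l x] l
      unfolding V_def spanned_verts_eq[OF rooted_tree_graft LG] mrca
      by (auto simp: L_def root_graft)
  qed
  have span_sel: "verts (spanned_subtree G L) = V" "arcs (spanned_subtree G L) = A"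
    "root (spanned_subtree G L) = (root S, ?r)"
    by (simp_all add: spanned_subtree_def V_def A_def mrca)
  have out_inner: "outdegree (spanned_subtree G L) (v, ?r) = outdegree S v"
    if v: "v \<in> verts S" "v \<notin> leaves S" for v
  proof -
    have "children (spanned_subtree G L) (v, ?r) = (\<lambda>w. (w, ?r)) ` children S v"
      using v V_inner arc_in_verts[OF S] by (auto simp: children_def span_sel A_def arcs_graft)
    then show ?thesis by (simp add: outdegree_def card_image inj_on_def)
  qed
  \<comment> \<open>Before its end, each vertex of the path has exactly one child in
    \<open>V\<close>, as siblings cannot both lie above \<open>f l\<close>.\<close>
  have K_leaf: "(l, x) \<in> K \<longleftrightarrow> x = f l" if l: "l \<in> leaves S" for l x
  proof (cases "(l, x) \<in> V")
    case False
    then show ?thesis using V_leaf[OF l] by (auto simp: K_def)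
  next
    case True
    then have x: "(x, f l) \<in> (arcs T)\<^sup>*" using V_leaf[OF l] by simp
    show ?thesis
    proof (cases "x = f l")
      case True
      then have "children (spanned_subtree G L) (l, x) = {}"
        using l fT(1)[OF l] by (auto simp: children_def span_sel A_def arcs_graft dest: leaf_no_child)
      then show ?thesis using \<open>(l, x) \<in> V\<close> True by (simp add: K_def outdegree_def)
    next
      case False
      then obtain y where y: "(x, y) \<in> arcs T" "(y, f l) \<in> (arcs T)\<^sup>*"
        using x by (auto elim: converse_rtranclE)
      have uniq: "z = y" if "(x, z) \<in> arcs T" "(z, f l) \<in> (arcs T)\<^sup>*" for z
        using siblings_no_common_descendant[OF T y(1) that(1) y(2) that(2)] by simp
      have "((l, x), (k, z)) \<in> A \<longleftrightarrow> k = l \<and> (x, z) \<in> arcs T \<and> (l, z) \<in> V" for k z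
        using l \<open>(l, x) \<in> V\<close> leaf_no_child[OF l] by (auto simp: A_def arcs_graft)
      then have "((l, x), (k, z)) \<in> A \<longleftrightarrow> (k, z) = (l, y)" for k z
        unfolding V_leaf[OF l] using y uniq by blast
      then have "children (spanned_subtree G L) (l, x) = {(l, y)}"
        by (auto simp: children_def span_sel)
      then show ?thesis using False by (simp add: K_def outdegree_def)
    qed
  qed
  have K_inner: "(v, x) \<in> K \<longleftrightarrow> x = ?r" if v: "v \<in> verts S" "v \<notin> leaves S" for v x
  proof -
    have "outdegree S v \<ge> 2" using v top_S by (simp add: topological_tree_def)
    then have "(v, ?r) \<in> K" using v V_inner out_inner by (simp add: K_def)
    moreover have "x = ?r" if "(v, x) \<in> V" using that V_sub v by (auto simp: verts_graft)
    ultimately show ?thesis by (auto simp: K_def)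
  qed
  have K_fst: "v \<in> verts S" if "(v, x) \<in> K" for v x
    using that V_sub by (auto simp: K_def verts_graft)
  have fst_g: "fst (g v) = v" for v by (simp add: g_def)
  have gK: "g v \<in> K" if "v \<in> verts S" for v
    using that K_leaf K_inner by (simp add: g_def)
  have g_fst: "fst p \<in> verts S" "g (fst p) = p" if "p \<in> K" for p
  proof -
    obtain v x where [simp]: "p = (v, x)" by fastforce
    show "fst p \<in> verts S" using K_fst that by simp
    then show "g (fst p) = p" using K_leaf[of v x] K_inner[of v x] that by (simp add: g_def)
  qed
  define R where "R = A \<inter> ((- K) \<times> UNIV)"
  \<comment> \<open>\<open>R\<close> consists of the arcs leaving suppressed vertices, so it can
    follow an attached path down to its end.\<close>
  have down: "((l, x), (l, f l)) \<in> R\<^sup>*" if l: "l \<in> leaves S" and "(x, f l) \<in> (arcs T)\<^sup>*" for l x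
    using that(2)
  proof (induction rule: converse_rtrancl_induct)
    case base
    show ?case by simp
  next
    case (step x y)
    then have "x \<noteq> f l" using leaf_no_child fT(1)[OF l] by metis
    moreover have "(l, x) \<in> V" "(l, y) \<in> V"
      using V_leaf[OF l] step.hyps by (auto intro: converse_rtrancl_into_rtrancl)
    ultimately have "((l, x), (l, y)) \<in> R"
      using step.hyps l K_leaf[OF l] by (auto simp: R_def A_def arcs_graft)
    then show ?case using step.IH by (rule converse_rtrancl_into_rtrancl)
  qed
  \<comment> \<open>\<open>R\<close> cannot leave \<open>(v, root T)\<close> for inner
    \<open>v\<close>, because that vertex is kept; for a leaf \<open>v\<close> the arcs of the graft
    remain in its copy. Thus a contracted arc uses exactly one arc of \<open>S\<close>.\<close>
  have stay: "fst p = v" if "((v, ?r), p) \<in> R\<^sup>*" and v: "v \<in> verts S" for v p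
    using that(1)
  proof induction
    case (step p q)
    obtain x y w where [simp]: "p = (v, x)" "q = (w, y)" using step.IH by (cases p, cases q) auto
    have "((v, x), (w, y)) \<in> arcs G" "(v, x) \<notin> K" "(v, x) \<in> V"
      using step.hyps by (auto simp: R_def A_def)
    moreover have "v \<in> leaves S"
    proof (rule ccontr)
      assume "v \<notin> leaves S"
      then show False using calculation V_sub v K_inner by (auto simp: verts_graft)
    qed
    ultimately show ?case by (auto simp: arcs_graft dest: leaf_no_child)
  qed simp
  have arcs_K: "(g u, g v) \<in> A O R\<^sup>* \<longleftrightarrow> (u, v) \<in> arcs S"
    if u: "u \<in> verts S" and v: "v \<in> verts S" for u v
  proof
    assume "(u, v) \<in> arcs S"
    then have nl: "u \<notin> leaves S" using leaf_no_child by metis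
    have "(g u, (v, ?r)) \<in> A"
      using nl u v V_inner \<open>(u, v) \<in> arcs S\<close> by (auto simp: g_def A_def arcs_graft)
    moreover have "((v, ?r), g v) \<in> R\<^sup>*"
    proof (cases "v \<in> leaves S")
      case True
      then have "(?r, f v) \<in> (arcs T)\<^sup>*" using fT T by (simp add: rooted_tree_def)
      then show ?thesis using down[OF True] True by (simp add: g_def)
    qed (simp add: g_def)
    ultimately show "(g u, g v) \<in> A O R\<^sup>*" by (rule relcompI)
  next
    assume "(g u, g v) \<in> A O R\<^sup>*"
    then obtain q where q: "(g u, q) \<in> A" "(q, g v) \<in> R\<^sup>*" by (rule relcompE) simp
    obtain w y where [simp]: "q = (w, y)" by fastforce
    have "u \<notin> leaves S"
    proof
      assume "u \<in> leaves S"
      then show False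
        using q(1) leaf_no_child[of u S] leaf_no_child[OF fT(1)] by (auto simp: g_def A_def arcs_graft)
    qed
    then have w: "(u, w) \<in> arcs S" "y = ?r"
      using q(1) by (auto simp: g_def A_def arcs_graft)
    then show "(u, v) \<in> arcs S"
      using stay[of w "g v"] q(2) arc_in_verts[OF S w(1)] fst_g by simp
  qed
  have ind: "induced_tree G L = \<lparr>verts = K, arcs = (A O R\<^sup>*) \<inter> (K \<times> K), root = (root S, ?r)\<rparr>"
    unfolding induced_tree_def suppress_def Let_def span_sel K_def[symmetric] R_def[symmetric] ..
  show ?thesis
    unfolding tree_iso_def ind
  proof (intro exI[of _ g] conjI ballI)
    show "bij_betw g (verts S) (verts \<lparr>verts = K, arcs = (A O R\<^sup>*) \<inter> (K \<times> K), root = (root S, ?r)\<rparr>)"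
      by (rule bij_betw_byWitness[where f' = fst]) (use fst_g g_fst gK in auto)
  qed (use root_S arcs_K gK in \<open>auto simp: g_def[of "root S"]\<close>)
qed

lemma copies_graft_ge:
  assumes "num_leaves S \<ge> 2"
  shows "copies S G \<ge> num_leaves S * copies S T + num_leaves T ^ num_leaves S"
proof -
  define C where "C = {L. L \<noteq> {} \<and> L \<subseteq> leaves T \<and> tree_iso S (induced_tree T L)}"
  define D where "D = {L. L \<noteq> {} \<and> L \<subseteq> leaves G \<and> tree_iso S (induced_tree G L)}"
  define A where "A = (\<lambda>(l, L). Pair l ` L) ` (leaves S \<times> C)"
  \<comment> \<open>Extensional functions are determined by their values on \<open>leaves S\<close>,
    so distinct ones have distinct graphs and \<open>B\<close> has exactly
    \<open>num_leaves T ^ num_leaves S\<close> elements.\<close>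
  define B where "B = (\<lambda>f. (\<lambda>l. (l, f l)) ` leaves S) ` (leaves S \<rightarrow>\<^sub>E leaves T)"
  have fin: "finite (leaves S)" "finite (leaves T)" "finite (leaves G)"
    using finite_leaves S T rooted_tree_graft by blast+
  have finC: "finite C" and finD: "finite D"
    using fin by (auto simp: C_def D_def)
  have "inj_on (\<lambda>(l, L). Pair l ` L) (leaves S \<times> C)"
  proof (rule inj_onI, clarsimp)
    fix l L k M assume "L \<in> C" "M \<in> C" and eq: "Pair l ` L = Pair k ` M"
    then have "L \<noteq> {}" by (simp add: C_def)
    then have "l = k" using eq by auto
    then show "l = k \<and> L = M" using eq by (simp add: inj_image_eq_iff inj_on_def)
  qed
  then have cardA: "card A = num_leaves S * copies S T"
    unfolding A_def by (simp add: card_image card_cartesian_product num_leaves_def copies_def C_def)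
  have "inj_on (\<lambda>f. (\<lambda>l. (l, f l)) ` leaves S) (leaves S \<rightarrow>\<^sub>E leaves T)"
  proof (rule inj_onI)
    fix f h assume fh: "f \<in> leaves S \<rightarrow>\<^sub>E leaves T" "h \<in> leaves S \<rightarrow>\<^sub>E leaves T"
      "(\<lambda>l. (l, f l)) ` leaves S = (\<lambda>l. (l, h l)) ` leaves S"
    show "f = h"
    proof (rule PiE_ext[OF fh(1,2)])
      fix l assume "l \<in> leaves S"
      then have "(l, f l) \<in> (\<lambda>l. (l, h l)) ` leaves S" using fh(3) by blast
      then show "f l = h l" by auto
    qed
  qed
  then have cardB: "card B = num_leaves T ^ num_leaves S"
    unfolding B_def using fin by (simp add: card_image card_PiE num_leaves_def)
  have "A \<subseteq> D"
  proof
    fix M assume "M \<in> A"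
    then obtain l L where l: "l \<in> leaves S" "L \<in> C" "M = Pair l ` L" by (auto simp: A_def)
    interpret subtree_embedding T G "Pair l" by (rule embedding_at_leaf[OF l(1)])
    show "M \<in> D" using copy_image[of L S] l by (simp add: C_def D_def)
  qed
  moreover have "B \<subseteq> D"
  proof
    fix M assume "M \<in> B"
    then obtain f where f: "f \<in> leaves S \<rightarrow> leaves T" "M = (\<lambda>l. (l, f l)) ` leaves S"
      by (auto simp: B_def PiE_def)
    have "leaves S \<noteq> {}" using assms by (auto simp: num_leaves_def)
    then show "M \<in> D"
      using f tree_iso_transversal[OF f(1)] by (auto simp: D_def leaves_graft)
  qed
  \<comment> \<open>The projection to \<open>S\<close> separates the families: one leaf for sets
    inside a single copy, at least two for transversals.\<close>
  moreover have "A \<inter> B = {}"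
  proof -
    have "card (fst ` M) \<le> 1" if "M \<in> A" for M
    proof -
      obtain l L where "M = Pair l ` L" using \<open>M \<in> A\<close> by (auto simp: A_def)
      then have "fst ` M \<subseteq> {l}" by auto
      then show ?thesis using card_mono[of "{l}" "fst ` M"] by simp
    qed
    moreover have "card (fst ` M) \<ge> 2" if "M \<in> B" for M
    proof -
      have "fst ` M = leaves S" using that by (auto simp: B_def image_image)
      then show ?thesis using assms by (simp add: num_leaves_def)
    qed
    ultimately show ?thesis by fastforce
  qed
  moreover have "finite A" "finite B" using calculation finD finite_subset by blast+
  ultimately have "card A + card B \<le> card D"
    using card_mono[OF finD, of "A \<union> B"] by (simp add: card_Un_disjoint)
  then show ?thesis by (simp add: cardA cardB copies_def D_def)
qed

end

subsection \<open>Relabelling the vertices\<close>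

text \<open>Grafting produces pairs as vertices, whereas \<open>max_density\<close> ranges over
  trees on \<open>nat\<close>; the relabelling brings each graft back to that type.\<close>

lemma rooted_tree_map_tree:
  assumes T: "rooted_tree T" and inj: "inj_on f (verts T)"
  shows "rooted_tree (map_tree f T)"
proof -
  have sub: "arcs T \<subseteq> verts T \<times> verts T" and root: "root T \<in> verts T"
    using T by (auto simp: rooted_tree_def)
  note iff = map_prod_image_iff[OF inj sub]
  show ?thesis
    unfolding rooted_tree_def map_tree_sel
  proof (intro conjI ballI allI)
    show "finite (f ` verts T)" "f (root T) \<in> f ` verts T"
      "map_prod f f ` arcs T \<subseteq> f ` verts T \<times> f ` verts T"
      using T root sub by (auto simp: rooted_tree_def)
    show "(y, f (root T)) \<notin> map_prod f f ` arcs T" for y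
    proof
      assume "(y, f (root T)) \<in> map_prod f f ` arcs T"
      then obtain u v where uv: "(u, v) \<in> arcs T" "f v = f (root T)" by auto
      then have "v = root T" using sub root inj_onD[OF inj] by blast
      then show False using uv T by (simp add: rooted_tree_def)
    qed
    show "(f (root T), y) \<in> (map_prod f f ` arcs T)\<^sup>*" if y: "y \<in> f ` verts T" for y
      using y T by (auto simp: rooted_tree_def intro: rtrancl_map_prod_imageI)
    fix y assume "y \<in> f ` verts T - {f (root T)}"
    then obtain v where v: "v \<in> verts T - {root T}" "y = f v" by blast
    then obtain u where u: "(u, v) \<in> arcs T" using T unfolding rooted_tree_def by blast
    show "\<exists>!x. (x, y) \<in> map_prod f f ` arcs T"
    proof (rule ex1I[of _ "f u"])
      show "(f u, y) \<in> map_prod f f ` arcs T" using u v by auto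
      fix x assume "(x, y) \<in> map_prod f f ` arcs T"
      then obtain u' v' where uv: "(u', v') \<in> arcs T" "x = f u'" "f v' = f v" using v by auto
      then have "v' = v" using sub v inj_onD[OF inj] by blast
      then show "x = f u" using parent_unique[OF T u] uv by blast
    qed
  qed
qed

lemma topological_tree_map_tree:
  assumes T: "topological_tree T" and inj: "inj_on f (verts T)"
  shows "topological_tree (map_tree f T)"
proof -
  have rT: "rooted_tree T" and sub: "arcs T \<subseteq> verts T \<times> verts T"
    using T by (auto simp: topological_tree_def rooted_tree_def)
  show ?thesis
    unfolding topological_tree_def leaves_map_tree[OF inj sub] map_tree_sel
    using rooted_tree_map_tree[OF rT inj] T outdegree_map_tree[OF inj sub]
    by (auto simp: topological_tree_def)
qed

lemma num_leaves_map_tree: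
  assumes T: "rooted_tree T" and inj: "inj_on f (verts T)"
  shows "num_leaves (map_tree f T) = num_leaves T"
proof -
  have "arcs T \<subseteq> verts T \<times> verts T" using T by (simp add: rooted_tree_def)
  then show ?thesis
    unfolding num_leaves_def leaves_map_tree[OF inj \<open>arcs T \<subseteq> _\<close>]
    by (intro card_image inj_on_subset[OF inj]) (auto simp: leaves_def)
qed

lemma copies_map_tree_ge:
  assumes T: "rooted_tree T" and inj: "inj_on f (verts T)"
  shows "copies S T \<le> copies S (map_tree f T)"
proof -
  have sub: "arcs T \<subseteq> verts T \<times> verts T" and root: "root T \<in> verts T"
    using T by (auto simp: rooted_tree_def)
  interpret subtree_embedding T "map_tree f T" f
    using assms rooted_tree_map_tree[OF assms] root children_map_tree[OF inj sub]
    by unfold_locales auto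
  have "finite (leaves (map_tree f T))"
    using finite_leaves rooted_tree_map_tree[OF assms] by blast
  then have fin: "finite {L. L \<noteq> {} \<and> L \<subseteq> leaves (map_tree f T) \<and> tree_iso S (induced_tree (map_tree f T) L)}"
    by simp
  show ?thesis
    unfolding copies_def
  proof (rule card_inj_on_le[OF _ _ fin])
    have "inj_on (image f) (Pow (verts T))" using inj by (simp add: inj_on_image_Pow)
    then show "inj_on (image f) {L. L \<noteq> {} \<and> L \<subseteq> leaves T \<and> tree_iso S (induced_tree T L)}"
      by (rule inj_on_subset) (auto simp: leaves_def)
  qed (use copy_image in blast)
qed

subsection \<open>Iterated grafting\<close>

lemma single_vertex_tree:
  "topological_tree \<lparr>verts = {v}, arcs = {}, root = v\<rparr>"
  "num_leaves \<lparr>verts = {v}, arcs = {}, root = v\<rparr> = 1"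
proof -
  have "leaves \<lparr>verts = {v}, arcs = {}, root = v\<rparr> = {v}"
    by (auto simp: leaves_def children_def)
  then show "topological_tree \<lparr>verts = {v}, arcs = {}, root = v\<rparr>"
    "num_leaves \<lparr>verts = {v}, arcs = {}, root = v\<rparr> = 1"
    by (auto simp: topological_tree_def rooted_tree_def num_leaves_def)
qed

lemma root_not_leaf:
  assumes "rooted_tree T" "num_leaves T \<ge> 2"
  shows "root T \<notin> leaves T"
proof
  assume r: "root T \<in> leaves T"
  have "v = root T" if "v \<in> verts T" for v
  proof -
    have "(root T, v) \<in> (arcs T)\<^sup>*" using assms(1) that by (simp add: rooted_tree_def)
    then show ?thesis using leaf_no_child[OF r] by (auto elim: converse_rtranclE)
  qed
  then have "leaves T \<subseteq> {root T}" by (auto simp: leaves_def)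
  then show False using assms(2) card_mono[of "{root T}" "leaves T"] by (simp add: num_leaves_def)
qed

text \<open>The bound is the exact solution of the recursion \<open>c (k+1) = s * c k + s^(k*s)\<close> with \<open>c 0 = 0\<close>.\<close>

lemma iterated_graft:
  fixes S :: "'v rooted_tree"
  assumes S: "topological_tree S" and s: "num_leaves S \<ge> 2"
  defines "s \<equiv> num_leaves S"
  shows "\<exists>T :: nat rooted_tree. topological_tree T \<and> num_leaves T = s ^ k \<and>
    real s ^ (k * s) - real s ^ k \<le> real (copies S T) * (real s ^ s - real s)"
proof (induction k)
  case 0
  show ?case using single_vertex_tree[of "0 :: nat"] s
    by (intro exI[of _ "\<lparr>verts = {0}, arcs = {}, root = 0\<rparr>"]) (simp add: s_def self_le_power)
next
  case (Suc k)
  then obtain T :: "nat rooted_tree" where tree: "topological_tree T" "num_leaves T = s ^ k"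
    "real s ^ (k * s) - real s ^ k \<le> real (copies S T) * (real s ^ s - real s)" by blast
  interpret graft_trees S T
    using S tree root_not_leaf s by unfold_locales (auto simp: topological_tree_def)
  have "finite (verts G)" using rooted_tree_graft by (simp add: rooted_tree_def)
  \<comment> \<open>Relabelling at every stage keeps the vertex type fixed, without which the
    induction could not be stated.\<close>
  then obtain f :: "'v \<times> nat \<Rightarrow> nat" where f: "inj_on f (verts G)"
    using finite_imp_inj_to_nat_seg[of "verts G"] by auto
  let ?T' = "map_tree f G"
  have "real s * real (copies S T) + real s ^ (k * s) \<le> real (copies S ?T')"
  proof -
    have "s * copies S T + (s ^ k) ^ s \<le> copies S G"
      using copies_graft_ge[OF s] unfolding tree(2) s_def[symmetric] .
    also have "\<dots> \<le> copies S ?T'" by (rule copies_map_tree_ge[OF rooted_tree_graft f])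
    finally have "s * copies S T + s ^ (k * s) \<le> copies S ?T'" by (simp only: power_mult)
    then have "real (s * copies S T + s ^ (k * s)) \<le> real (copies S ?T')"
      by (rule of_nat_mono)
    then show ?thesis by simp
  qed
  moreover have ge: "real s ^ s - real s \<ge> 0"
    using s self_le_power[of "real s" s] by (simp add: s_def)
  ultimately have "(real s * real (copies S T) + real s ^ (k * s)) * (real s ^ s - real s)
      \<le> real (copies S ?T') * (real s ^ s - real s)"
    by (rule mult_right_mono)
  moreover have "real s * (real s ^ (k * s) - real s ^ k)
      \<le> real s * (real (copies S T) * (real s ^ s - real s))"
    by (intro mult_left_mono tree(3)) simp
  ultimately have "real s * (real s ^ (k * s) - real s ^ k) + real s ^ (k * s) * (real s ^ s - real s)
      \<le> real (copies S ?T') * (real s ^ s - real s)"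
    by (simp add: algebra_simps)
  \<comment> \<open>On the left the terms \<open>s * s ^ (k * s)\<close> cancel, and the two
    remaining ones are the bound for \<open>Suc k\<close>.\<close>
  then have "real s ^ (Suc k * s) - real s ^ Suc k \<le> real (copies S ?T') * (real s ^ s - real s)"
    by (simp add: algebra_simps power_add)
  moreover have "topological_tree ?T'"
    by (rule topological_tree_map_tree[OF topological_tree_graft f])
  moreover have "num_leaves ?T' = s ^ Suc k"
    by (simp add: num_leaves_map_tree[OF rooted_tree_graft f] num_leaves_graft tree(2) s_def)
  ultimately show ?case by blast
qed

section \<open>From numbers of copies to densities and their limit superior\<close>

lemma density_le_max_density:
  fixes T :: "nat rooted_tree"
  assumes "topological_tree T"
  shows "density S T \<le> max_density S (num_leaves T)"
proof -
  let ?n = "num_leaves T"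
  let ?D = "{density S T' | T' :: nat rooted_tree. topological_tree T' \<and> num_leaves T' = ?n}"
  \<comment> \<open>\<open>Max\<close> is an upper bound only on a finite set. The bound on
    \<open>copies\<close>, with the denominator fixed by the number of leaves, leaves finitely many
    densities.\<close>
  have "copies S T' \<le> 2 ^ num_leaves T'" if "topological_tree T'" for T' :: "nat rooted_tree"
  proof -
    have fin: "finite (leaves T')"
      using that finite_leaves by (auto simp: topological_tree_def)
    have "copies S T' \<le> card (Pow (leaves T'))"
      unfolding copies_def using fin by (intro card_mono) auto
    then show ?thesis using fin by (simp add: card_Pow num_leaves_def)
  qed
  then have "?D \<subseteq> (\<lambda>c. real c / real (?n choose num_leaves S)) ` {..2 ^ ?n}"
    by (fastforce simp: density_def)
  then have "finite ?D" using finite_subset by blast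
  then show ?thesis
    unfolding max_density_def using assms by (intro Max_ge) auto
qed

lemma max_density_power_ge:
  fixes S :: "'v rooted_tree"
  assumes S: "topological_tree S" and s: "num_leaves S \<ge> 2"
  defines "s \<equiv> num_leaves S"
  shows "fact (s - 1) / (real s ^ (s - 1) - 1) * (1 - (1 / real s ^ (s - 1)) ^ Suc k)
    \<le> max_density S (s ^ Suc k)"
proof -
  define m where "m = Suc k"
  obtain T :: "nat rooted_tree" where T: "topological_tree T" "num_leaves T = s ^ m"
    "real s ^ (m * s) - real s ^ m \<le> real (copies S T) * (real s ^ s - real s)"
    using iterated_graft[OF S s] unfolding s_def by blast
  obtain t where t: "s = Suc t" "t \<ge> 1" using s by (cases "num_leaves S") (auto simp: s_def)
  \<comment> \<open>\<open>q\<close> is the inverse ratio of the geometric series. With it,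
    \<open>s^s - s = s * (q - 1)\<close> and \<open>s^(m*s) = s^m * q^m\<close>, so the left side of
    the bound on copies is \<open>s^(m*s) * (1 - (1/q)^m)\<close>.\<close>
  define q where "q = real s ^ t"
  have q: "q > 1" using t by (simp add: q_def)
  have s_pos: "real s > 0" using t by simp
  \<comment> \<open>Here \<open>m\<close> being a successor matters: it makes the binomial
    coefficient positive, so that dividing by it is legitimate.\<close>
  have "s \<le> s ^ m" using t by (intro self_le_power) (auto simp: m_def)
  then have binom: "0 < real (s ^ m choose s)" by simp
  have "(s ^ m choose s) * fact s \<le> (s ^ m) ^ s" by (rule binomial_fact_pow)
  then have "real ((s ^ m choose s) * fact s) \<le> real ((s ^ m) ^ s)" by (rule of_nat_mono)
  then have le: "real (s ^ m choose s) * fact s \<le> real s ^ (m * s)"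
    by (simp add: power_mult)
  have ss: "real s ^ s - real s = real s * (q - 1)"
    by (simp add: t q_def algebra_simps)
  have qm: "real s ^ (m * s) = real s ^ m * q ^ m"
    by (simp add: t q_def power_add power_mult[symmetric] mult.commute)
  let ?x = "1 - (1 / q) ^ m"
  have x: "?x \<ge> 0" using q by (simp add: power_le_one)
  have "real s ^ (m * s) * ?x \<le> real (copies S T) * (real s * (q - 1))"
    using T(3) q unfolding ss qm by (simp add: algebra_simps power_one_over)
  moreover have "real (s ^ m choose s) * fact s * ?x \<le> real s ^ (m * s) * ?x"
    by (rule mult_right_mono[OF le x])
  \<comment> \<open>The factor \<open>s\<close> split off here cancels against that in
    \<open>s * (q - 1)\<close>, which turns \<open>s!\<close> into \<open>(s-1)!\<close>.\<close>
  moreover have "(fact s :: real) = real s * fact t" by (simp add: t)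
  ultimately have "real s * (fact t * ?x * real (s ^ m choose s))
      \<le> real s * (real (copies S T) * (q - 1))"
    by (simp add: mult_ac)
  then have "fact t * ?x * real (s ^ m choose s) \<le> real (copies S T) * (q - 1)"
    using s_pos by simp
  then have "fact t / (q - 1) * ?x \<le> density S T"
    using q binom unfolding density_def T(2) s_def[symmetric]
    by (simp add: field_simps)
  also have "\<dots> \<le> max_density S (s ^ m)"
    using density_le_max_density[OF T(1)] T(2) by metis
  finally show ?thesis
    by (simp add: t(1) q_def m_def)
qed

theorem proposition10:
  fixes S :: "'v rooted_tree"
  assumes "topological_tree S"
    and "num_leaves S \<ge> 2"
  shows "inducibility S \<ge>
    ereal (fact (num_leaves S - 1) / (real (num_leaves S) ^ (num_leaves S - 1) - 1))"
proof -
  define s where "s = num_leaves S"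
  define b where "b = fact (s - 1) / (real s ^ (s - 1) - 1)"
  define q where "q = real s ^ (s - 1)"
  have s: "s \<ge> 2" using assms(2) by (simp add: s_def)
  then have "q > 1" by (simp add: q_def)
  then have "(\<lambda>k. (1 / q) ^ Suc k) \<longlonglongrightarrow> 0"
    by (intro LIMSEQ_Suc LIMSEQ_realpow_zero) auto
  then have "(\<lambda>k. b * (1 - (1 / q) ^ Suc k)) \<longlonglongrightarrow> b * (1 - 0)"
    by (intro tendsto_intros)
  then have "(\<lambda>k. ereal (b * (1 - (1 / q) ^ Suc k))) \<longlonglongrightarrow> ereal b" by simp
  then have "ereal b = limsup (\<lambda>k. ereal (b * (1 - (1 / q) ^ Suc k)))"
    by (intro lim_imp_Limsup[symmetric]) auto
  also have "\<dots> \<le> limsup (\<lambda>k. ereal (max_density S (s ^ Suc k)))"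
    using max_density_power_ge[OF assms, folded s_def]
    by (intro Limsup_mono always_eventually allI) (simp only: b_def q_def ereal_less_eq)
  also have "\<dots> \<le> limsup (\<lambda>n. ereal (max_density S n))"
  proof -
    \<comment> \<open>Since \<open>s\<close> is at least 2, the leaf counts \<open>s ^ Suc k\<close>
      index a genuine subsequence.\<close>
    have "strict_mono (\<lambda>k. s ^ Suc k)" using s by (intro strict_monoI power_strict_increasing) auto
    from limsup_subseq_mono[OF this, of "\<lambda>n. ereal (max_density S n)"]
    show ?thesis by (simp only: comp_def)
  qed
  finally show ?thesis
    unfolding inducibility_def b_def s_def .
qed

end
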